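(* Let $R\ge 2$ be an even integer, and let $(p^{n+\frac12},E^{n+\frac12},H^{n+1})$, $n=0,\dots,N-1$, be the time-semidiscrete solution given by the LF$_R$ scheme (bootstrapping equations (B1)–(B3) for $n=0$ and equations (S1)–(S3) for $n=1,\dots,N-1$, as written in the context) with initial data $(p_0,E_0,H_0)$. Then for any fixed time step $\Delta t>0$ sufficiently small, $$\|p^{N-\frac12}\|_{\varepsilon^{-1}}^2+\|E^{N-\frac12}\|_{\varepsilon}^2+\|H^{N}\|_{\mu}^2=\|p_0\|_{\varepsilon^{-1}}^2+\|E_0\|_{\varepsilon}^2+\|H_0\|_{\mu}^2 .$$
   Context: Setting. $\Omega\subset\mathbb R^2$ or $\mathbb R^3$ is a domain with Lipschitz boundary and unit outward normal $n$; $T>0$; $\varepsilon,\mu>0$ are constants. $\langle\cdot,\cdot\rangle$ is the $L^2(\Omega)$ inner product, and for a weight $w\in\{\varepsilon^{-1},\varepsilon,\mu\}$, $\|u\|_w^2:=\langle w u,u\rangle$. $\mathring H^1_{\varepsilon^{-1}}(\Omega)$, $\mathring H_\varepsilon(\mathrm{curl};\Omega)$, $\mathring H_\mu(\mathrm{div};\Omega)$ are the usual spaces $H^1$, $H(\mathrm{curl})$, $H(\mathrm{div})$ with $L^2$ norms weighted by the subscript and with the homogeneous boundary conditions $p=0$, $E\times n=0$, $H\cdot n=0$ on $\partial\Omega$, respectively. (In $\mathbb R^2$, $H$ is scalar, with the usual scalar/vector curls.) Initial data $p_0,E_0,H_0$ in these spaces satisfy $\nabla\cdot(\varepsilon E_0)=p_0$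 and $\nabla\cdot(\mu H_0)=0$. The scheme discretizes the three-field Maxwell system $\partial_t p+\nabla\cdot(\varepsilon E)=0$, $\nabla p+\varepsilon\,\partial_t E-\nabla\times H=0$, $\mu\,\partial_t H+\nabla\times E=0$ in $\Omega\times(0,T]$. Time grid: $\Delta t>0$, $N\Delta t=T$, $t^n=n\Delta t$, $t^{n+\frac12}=(n+\frac12)\Delta t$. Coefficients. Let $\mathcal K_R$ be the set of all tuples $k=(k_1,\dots,k_a)$ of integers $k_i\ge1$ of any length $1\le a\le \frac R2-1$ with $|k|:=k_1+\dots+k_a\le\frac R2-1$ (empty if $R=2$). Put $C_{k_1}:=\frac1{(2k_1)!}-\frac1{(2k_1+1)!}$ and $$\gamma_k:=(-1)^{a-1}\,C_{k_1}\Big(\prod_{c=2}^{a}\frac1{(2k_c)!}\Big)\Big(\frac{\Delta t}{2}\Big)^{2|k|}.$$ Write $(\nabla\nabla\cdot)^m$ and $(\nabla\times\nabla\times)^m$ for the $m$-fold compositions of $\nabla\nabla\cdot$ and $\nabla\times\nabla\times$. LF$_R$ scheme. For $n=1,\dots,N-1$, with $\bar E=E^{n+\frac12}+E^{n-\frac12}$, $\bar p=p^{n+\frac12}+p^{n-\frac12}$, $\bar H=H^{n+1}+H^n$, for all test functions $\tilde p\in\mathring H^1_{\varepsilon^{-1}}(\Omega)$, $\tilde E\in\mathring H_\varepsilon(\mathrm{curl};\Omega)$, $\tilde H\in\mathring H_\mu(\mathrm{div};\Omega)$: (S1) $\big\langle\frac{p^{n+\frac12}-p^{n-\frac12}}{\Delta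 t},\tilde p\big\rangle-\langle\frac\varepsilon2\bar E,\nabla\tilde p\rangle+\sum_{k\in\mathcal K_R}\gamma_k\langle\frac\varepsilon2(\nabla\nabla\cdot)^{|k|}\bar E,\nabla\tilde p\rangle=0$; (S2) $\langle\frac12\nabla\bar p,\tilde E\rangle-\sum_{k\in\mathcal K_R}\gamma_k\langle\frac12\nabla\bar p,(\nabla\nabla\cdot)^{|k|}\tilde E\rangle+\big\langle\varepsilon\frac{E^{n+\frac12}-E^{n-\frac12}}{\Delta t},\tilde E\big\rangle-\langle\frac12\bar H,\nabla\times\tilde E\rangle+\sum_{k\in\mathcal K_R}\gamma_k(-1)^{|k|}\langle\frac12(\mu\varepsilon)^{-|k|}(\nabla\times\nabla\times)^{|k|}\bar H,\nabla\times\tilde E\rangle=0$; (S3) $\big\langle\mu\frac{H^{n+1}-H^n}{\Delta t},\tilde H\big\rangle+\langle\frac12\nabla\times\bar E,\tilde H\rangle-\sum_{k\in\mathcal K_R}\gamma_k(-1)^{|k|}\langle\frac12(\varepsilon\mu)^{-|k|}\nabla\times\bar E,(\nabla\times\nabla\times)^{|k|}\tilde H\rangle=0$. Bootstrapping ($n=0$), for all such test functions: (B1) $\big\langle\frac{p^{\frac12}-p_0}{\Delta t/2},\tilde p\big\rangle-\frac12\langle\frac\varepsilon2(E^{\frac12}+E_0),\nabla\tilde p\rangle+\sum_{k\in\mathcal K_R}\frac{\gamma_k}{2^{2|k|+1}}\langle\frac\varepsilon2(\nabla\nabla\cdot)^{|k|}(E^{\frac12}+E_0),\nabla\tilde p\rangle=0$;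 (B2) $\frac12\langle\frac12\nabla(p^{\frac12}+p_0),\tilde E\rangle-\sum_{k\in\mathcal K_R}\frac{\gamma_k}{2^{2|k|+1}}\langle\frac12\nabla(p^{\frac12}+p_0),(\nabla\nabla\cdot)^{|k|}\tilde E\rangle+\big\langle\varepsilon\frac{E^{\frac12}-E_0}{\Delta t/2},\tilde E\big\rangle-\langle\frac12(H^1+H_0),\nabla\times\tilde E\rangle+\sum_{k\in\mathcal K_R}\frac{\gamma_k}{2^{2|k|}}(-1)^{|k|}\langle\frac12(\mu\varepsilon)^{-|k|}(\nabla\times\nabla\times)^{|k|}(H^1+H_0),\nabla\times\tilde E\rangle=0$; (B3) $\big\langle\mu\frac{H^1-H_0}{\Delta t},\tilde H\big\rangle+\frac12\langle\frac12\nabla\times(E^{\frac12}+E_0),\tilde H\rangle-\sum_{k\in\mathcal K_R}\frac{\gamma_k}{2^{2|k|+1}}(-1)^{|k|}\langle\frac12(\varepsilon\mu)^{-|k|}\nabla\times(E^{\frac12}+E_0),(\nabla\times\nabla\times)^{|k|}\tilde H\rangle=0$. Standing regularity assumption: the solutions (and the test functions in the higher-order terms) are regular enough that every expression in the scheme is meaningful, and the discrete solutions themselves are admissible as test functions. *)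

theory Defs
  imports "HOL-Analysis.Analysis"
begin

section \<open>Domains\<close>

text \<open>
  Locally, after a rotation sending \<open>\<nu>\<close> to the vertical axis, the domain is the part of a ball lying
  strictly above a Lipschitz graph. Only the values of \<open>g\<close> on the hyperplane orthogonal to \<open>\<nu>\<close> matter.
\<close>

definition lipschitz_boundary :: "'a::euclidean_space set \<Rightarrow> bool" where
  "lipschitz_boundary \<Omega> \<longleftrightarrow>
     (\<forall>x\<in>frontier \<Omega>. \<exists>r>0. \<exists>\<nu>. \<exists>g :: 'a \<Rightarrow> real. \<exists>L.
        norm \<nu> = 1 \<and> L-lipschitz_on UNIV g \<and>
        \<Omega> \<inter> ball x r = {y \<in> ball x r. g (y - (y \<bullet> \<nu>) *\<^sub>R \<nu>) < y \<bullet> \<nu>})"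

definition lipschitz_domain :: "'a::euclidean_space set \<Rightarrow> bool" where
  "lipschitz_domain \<Omega> \<longleftrightarrow> open \<Omega> \<and> connected \<Omega> \<and> \<Omega> \<noteq> {} \<and> lipschitz_boundary \<Omega>"

section \<open>Square-integrable functions\<close>

text \<open>Elements are functions rather than classes modulo null sets.\<close>

definition L2 :: "'a::euclidean_space set \<Rightarrow> ('a \<Rightarrow> 'b::euclidean_space) set" where
  "L2 \<Omega> = {u. u \<in> borel_measurable (lebesgue_on \<Omega>) \<and>
              integrable (lebesgue_on \<Omega>) (\<lambda>x. (norm (u x))\<^sup>2)}"

definition L2_inner ::
    "'a::euclidean_space set \<Rightarrow> ('a \<Rightarrow> 'b::euclidean_space) \<Rightarrow> ('a \<Rightarrow> 'b) \<Rightarrow> real" where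
  "L2_inner \<Omega> u v = integral\<^sup>L (lebesgue_on \<Omega>) (\<lambda>x. u x \<bullet> v x)"

definition wnorm_sq ::
    "'a::euclidean_space set \<Rightarrow> real \<Rightarrow> ('a \<Rightarrow> 'b::euclidean_space) \<Rightarrow> real" where
  "wnorm_sq \<Omega> w u = L2_inner \<Omega> (\<lambda>x. w *\<^sub>R u x) u"

section \<open>Smooth compactly supported functions and their classical derivatives\<close>

primrec C_k :: "nat \<Rightarrow> ('a::euclidean_space \<Rightarrow> 'b::euclidean_space) \<Rightarrow> bool" where
  "C_k 0 f \<longleftrightarrow> continuous_on UNIV f"
| "C_k (Suc k) f \<longleftrightarrow> (\<forall>x. f differentiable (at x)) \<and>
     (\<forall>b\<in>Basis. C_k k (\<lambda>x. frechet_derivative f (at x) b))"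

definition test_fns :: "'a::euclidean_space set \<Rightarrow> ('a \<Rightarrow> 'b::euclidean_space) set" where
  "test_fns \<Omega> = {\<phi>. (\<forall>k. C_k k \<phi>) \<and> compact (closure {x. \<phi> x \<noteq> 0}) \<and> closure {x. \<phi> x \<noteq> 0} \<subseteq> \<Omega>}"

definition pd :: "'d::finite \<Rightarrow> (real^'d \<Rightarrow> real) \<Rightarrow> real^'d \<Rightarrow> real" where
  "pd i f x = frechet_derivative f (at x) (axis i 1)"

definition grad :: "(real^'d::finite \<Rightarrow> real) \<Rightarrow> real^'d \<Rightarrow> real^'d" where
  "grad f x = (\<chi> i. pd i f x)"

definition diverg :: "(real^'d::finite \<Rightarrow> real^'d) \<Rightarrow> real^'d \<Rightarrow> real" where
  "diverg u x = (\<Sum>i\<in>UNIV. pd i (\<lambda>y. u y $ i) x)"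

definition curl3 :: "(real^3 \<Rightarrow> real^3) \<Rightarrow> real^3 \<Rightarrow> real^3" where
  "curl3 u x = vector
     [pd 2 (\<lambda>y. u y $ 3) x - pd 3 (\<lambda>y. u y $ 2) x,
      pd 3 (\<lambda>y. u y $ 1) x - pd 1 (\<lambda>y. u y $ 3) x,
      pd 1 (\<lambda>y. u y $ 2) x - pd 2 (\<lambda>y. u y $ 1) x]"

text \<open>In the plane: the scalar curl of a vector field and the vector curl of a scalar field.\<close>

definition scurl2 :: "(real^2 \<Rightarrow> real^2) \<Rightarrow> real^2 \<Rightarrow> real" where
  "scurl2 u x = pd 1 (\<lambda>y. u y $ 2) x - pd 2 (\<lambda>y. u y $ 1) x"

definition vcurl2 :: "(real^2 \<Rightarrow> real) \<Rightarrow> real^2 \<Rightarrow> real^2" where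
  "vcurl2 f x = vector [pd 2 f x, - pd 1 f x]"

section \<open>Weak derivatives\<close>

text \<open>
  \<open>has_weak \<Omega> A u v\<close>: the \<open>L2\<close> function \<open>v\<close> is the distributional image of \<open>u\<close> under the first-order
  operator whose formal adjoint is \<open>A\<close>. Such a \<open>v\<close> is unique up to null sets; \<open>weak\<close> selects a
  representative, and is meaningful only if there is one.
\<close>

definition has_weak :: "'a::euclidean_space set \<Rightarrow>
    (('a \<Rightarrow> 'c::euclidean_space) \<Rightarrow> 'a \<Rightarrow> 'b::euclidean_space) \<Rightarrow> ('a \<Rightarrow> 'b) \<Rightarrow> ('a \<Rightarrow> 'c) \<Rightarrow> bool" where
  "has_weak \<Omega> A u v \<longleftrightarrow> u \<in> L2 \<Omega> \<and> v \<in> L2 \<Omega> \<and>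
     (\<forall>\<phi>\<in>test_fns \<Omega>. L2_inner \<Omega> u (A \<phi>) = L2_inner \<Omega> v \<phi>)"

definition weak :: "'a::euclidean_space set \<Rightarrow>
    (('a \<Rightarrow> 'c::euclidean_space) \<Rightarrow> 'a \<Rightarrow> 'b::euclidean_space) \<Rightarrow> ('a \<Rightarrow> 'b) \<Rightarrow> 'a \<Rightarrow> 'c" where
  "weak \<Omega> A u = (SOME v. has_weak \<Omega> A u v)"

text \<open>The formal adjoints of gradient and divergence; the curls are adjoint to one another.\<close>

definition grad_adj :: "(real^'d::finite \<Rightarrow> real^'d) \<Rightarrow> real^'d \<Rightarrow> real" where
  "grad_adj \<phi> x = - diverg \<phi> x"

definition div_adj :: "(real^'d::finite \<Rightarrow> real) \<Rightarrow> real^'d \<Rightarrow> real^'d" where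
  "div_adj \<phi> x = - grad \<phi> x"

definition wgrad :: "(real^'d::finite) set \<Rightarrow> (real^'d \<Rightarrow> real) \<Rightarrow> real^'d \<Rightarrow> real^'d" where
  "wgrad \<Omega> = weak \<Omega> grad_adj"

definition wdiv :: "(real^'d::finite) set \<Rightarrow> (real^'d \<Rightarrow> real^'d) \<Rightarrow> real^'d \<Rightarrow> real" where
  "wdiv \<Omega> = weak \<Omega> div_adj"

definition wcurl3 :: "(real^3) set \<Rightarrow> (real^3 \<Rightarrow> real^3) \<Rightarrow> real^3 \<Rightarrow> real^3" where
  "wcurl3 \<Omega> = weak \<Omega> curl3"

definition wscurl2 :: "(real^2) set \<Rightarrow> (real^2 \<Rightarrow> real^2) \<Rightarrow> real^2 \<Rightarrow> real" where
  "wscurl2 \<Omega> = weak \<Omega> vcurl2"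

definition wvcurl2 :: "(real^2) set \<Rightarrow> (real^2 \<Rightarrow> real) \<Rightarrow> real^2 \<Rightarrow> real^2" where
  "wvcurl2 \<Omega> = weak \<Omega> scurl2"

text \<open>
  \<open>pow_dom \<Omega> A B m\<close> is the domain of the \<open>m\<close>-fold composition of \<open>weak \<Omega> B \<circ> weak \<Omega> A\<close>: all
  intermediate weak derivatives exist in \<open>L2\<close>.
\<close>

primrec pow_dom :: "'a::euclidean_space set \<Rightarrow>
    (('a \<Rightarrow> 'c::euclidean_space) \<Rightarrow> 'a \<Rightarrow> 'b::euclidean_space) \<Rightarrow> (('a \<Rightarrow> 'b) \<Rightarrow> 'a \<Rightarrow> 'c) \<Rightarrow>
    nat \<Rightarrow> ('a \<Rightarrow> 'b) set" where
  "pow_dom \<Omega> A B 0 = L2 \<Omega>"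
| "pow_dom \<Omega> A B (Suc m) =
     {u. \<exists>v w. has_weak \<Omega> A u v \<and> has_weak \<Omega> B v w \<and> w \<in> pow_dom \<Omega> A B m}"

section \<open>Spaces with homogeneous boundary conditions\<close>

text \<open>
  Given a first-order operator \<open>D\<close> with formal adjoint \<open>A\<close>, this is the closure of the test functions
  in the graph norm of \<open>D\<close> with weight \<open>w\<close>. On a Lipschitz domain, for \<open>D\<close> the gradient, curl or
  divergence, this closure is the subspace of \<open>H\<^sup>1\<close>, \<open>H(curl)\<close> or \<open>H(div)\<close> with vanishing trace, vanishing
  tangential trace or vanishing normal trace respectively.
\<close>

definition graph_closure :: "'a::euclidean_space set \<Rightarrow> real \<Rightarrow>
    (('a \<Rightarrow> 'b::euclidean_space) \<Rightarrow> 'a \<Rightarrow> 'c::euclidean_space) \<Rightarrow>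
    (('a \<Rightarrow> 'c) \<Rightarrow> 'a \<Rightarrow> 'b) \<Rightarrow> ('a \<Rightarrow> 'b) set" where
  "graph_closure \<Omega> w D A = {u. \<exists>v. has_weak \<Omega> A u v \<and>
     (\<exists>\<phi> :: nat \<Rightarrow> 'a \<Rightarrow> 'b. (\<forall>j. \<phi> j \<in> test_fns \<Omega>) \<and>
        (\<lambda>j. wnorm_sq \<Omega> w (\<lambda>x. u x - \<phi> j x) + wnorm_sq \<Omega> w (\<lambda>x. v x - D (\<phi> j) x))
          \<longlonglongrightarrow> 0)}"

definition H1_0 :: "(real^'d::finite) set \<Rightarrow> real \<Rightarrow> (real^'d \<Rightarrow> real) set" where
  "H1_0 \<Omega> w = graph_closure \<Omega> w grad grad_adj"

definition Hcurl3_0 :: "(real^3) set \<Rightarrow> real \<Rightarrow> (real^3 \<Rightarrow> real^3) set" where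
  "Hcurl3_0 \<Omega> w = graph_closure \<Omega> w curl3 curl3"

definition Hdiv3_0 :: "(real^3) set \<Rightarrow> real \<Rightarrow> (real^3 \<Rightarrow> real^3) set" where
  "Hdiv3_0 \<Omega> w = graph_closure \<Omega> w diverg div_adj"

definition Hcurl2_0 :: "(real^2) set \<Rightarrow> real \<Rightarrow> (real^2 \<Rightarrow> real^2) set" where
  "Hcurl2_0 \<Omega> w = graph_closure \<Omega> w scurl2 vcurl2"

text \<open>
  A scalar \<open>H\<close> in the plane stands for the field \<open>(0, 0, H(x\<^sub>1, x\<^sub>2))\<close>, which is divergence free and
  tangential to the boundary. So the divergence and normal-trace conditions are void.
\<close>

definition Hdiv2_0 :: "(real^2) set \<Rightarrow> (real^2 \<Rightarrow> real) set" where
  "Hdiv2_0 \<Omega> = L2 \<Omega>"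

section \<open>Coefficients of the scheme\<close>

definition K_set :: "nat \<Rightarrow> nat list set" where
  "K_set R = {k. 1 \<le> length k \<and> length k \<le> R div 2 - 1 \<and> (\<forall>i\<in>set k. 1 \<le> i) \<and>
                 sum_list k \<le> R div 2 - 1}"

lemma finite_K_set: "finite (K_set R)"
proof (rule finite_subset)
  show "K_set R \<subseteq> {k. set k \<subseteq> {..R div 2 - 1} \<and> length k \<le> R div 2 - 1}"
  proof
    fix k assume k: "k \<in> K_set R"
    have "i \<le> sum_list k" if "i \<in> set k" for i
      using that by (simp add: member_le_sum_list)
    then show "k \<in> {k. set k \<subseteq> {..R div 2 - 1} \<and> length k \<le> R div 2 - 1}"
      using k unfolding K_set_def by fastforce
  qed
  show "finite {k. set k \<subseteq> {..R div 2 - 1} \<and> length k \<le> R div 2 - 1}"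
    by (rule finite_lists_length_le) simp
qed

definition C_coef :: "nat \<Rightarrow> real" where
  "C_coef k = 1 / fact (2 * k) - 1 / fact (2 * k + 1)"

definition gamma_coef :: "real \<Rightarrow> nat list \<Rightarrow> real" where
  "gamma_coef dt k = (-1) ^ (length k - 1) * C_coef (hd k) *
     (\<Prod>c\<leftarrow>tl k. 1 / fact (2 * c)) * (dt / 2) ^ (2 * sum_list k)"

section \<open>The scheme\<close>

text \<open>
  The parameters \<open>cE\<close> and \<open>cH\<close> are the (weak) curls acting on electric and magnetic fields, and \<open>Vp\<close>,
  \<open>VE\<close>, \<open>VH\<close> are the spaces of test functions. In three dimensions both curls are \<open>wcurl3\<close>; in two
  dimensions they are the scalar and the vector curl. Primed variables denote values at the new time.
\<close>

definition graddiv_pow :: "(real^'d::finite) set \<Rightarrow> nat \<Rightarrow> (real^'d \<Rightarrow> real^'d) \<Rightarrow> real^'d \<Rightarrow> real^'d" where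
  "graddiv_pow \<Omega> m = (\<lambda>u. wgrad \<Omega> (wdiv \<Omega> u)) ^^ m"

definition curlcurl_pow :: "((real^'d::finite \<Rightarrow> real^'d) \<Rightarrow> real^'d \<Rightarrow> 'h::euclidean_space) \<Rightarrow>
    ((real^'d \<Rightarrow> 'h) \<Rightarrow> real^'d \<Rightarrow> real^'d) \<Rightarrow> nat \<Rightarrow> (real^'d \<Rightarrow> 'h) \<Rightarrow> real^'d \<Rightarrow> 'h" where
  "curlcurl_pow cE cH m = (\<lambda>u. cE (cH u)) ^^ m"

definition LF_step where
  "LF_step (\<Omega> :: (real^'d::finite) set) Vp VE VH cE cH (\<epsilon>::real) (\<mu>::real) (dt::real) (R::nat)
     p E (H :: real^'d \<Rightarrow> 'h::euclidean_space) p' E' H' \<longleftrightarrow>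
   (let ps = (\<lambda>x. p' x + p x); Es = (\<lambda>x. E' x + E x); Hs = (\<lambda>x. H' x + H x) in
    (\<forall>q\<in>Vp.
       L2_inner \<Omega> (\<lambda>x. (p' x - p x) / dt) q
       - L2_inner \<Omega> (\<lambda>x. (\<epsilon> / 2) *\<^sub>R Es x) (wgrad \<Omega> q)
       + (\<Sum>k\<in>K_set R. gamma_coef dt k *
            L2_inner \<Omega> (\<lambda>x. (\<epsilon> / 2) *\<^sub>R graddiv_pow \<Omega> (sum_list k) Es x) (wgrad \<Omega> q)) = 0) \<and>
    (\<forall>F\<in>VE.
       L2_inner \<Omega> (\<lambda>x. (1 / 2) *\<^sub>R wgrad \<Omega> ps x) F
       - (\<Sum>k\<in>K_set R. gamma_coef dt k *
            L2_inner \<Omega> (\<lambda>x. (1 / 2) *\<^sub>R wgrad \<Omega> ps x) (graddiv_pow \<Omega> (sum_list k) F))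
       + L2_inner \<Omega> (\<lambda>x. \<epsilon> *\<^sub>R ((E' x - E x) /\<^sub>R dt)) F
       - L2_inner \<Omega> (\<lambda>x. (1 / 2) *\<^sub>R Hs x) (cE F)
       + (\<Sum>k\<in>K_set R. gamma_coef dt k * (-1) ^ sum_list k *
            L2_inner \<Omega> (\<lambda>x. (1 / 2 * inverse ((\<mu> * \<epsilon>) ^ sum_list k)) *\<^sub>R
                              curlcurl_pow cE cH (sum_list k) Hs x) (cE F)) = 0) \<and>
    (\<forall>G\<in>VH.
       L2_inner \<Omega> (\<lambda>x. \<mu> *\<^sub>R ((H' x - H x) /\<^sub>R dt)) G
       + L2_inner \<Omega> (\<lambda>x. (1 / 2) *\<^sub>R cE Es x) G
       - (\<Sum>k\<in>K_set R. gamma_coef dt k * (-1) ^ sum_list k *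
            L2_inner \<Omega> (\<lambda>x. (1 / 2 * inverse ((\<epsilon> * \<mu>) ^ sum_list k)) *\<^sub>R cE Es x)
                        (curlcurl_pow cE cH (sum_list k) G)) = 0))"

definition LF_bootstrap where
  "LF_bootstrap (\<Omega> :: (real^'d::finite) set) Vp VE VH cE cH (\<epsilon>::real) (\<mu>::real) (dt::real) (R::nat)
     p E (H :: real^'d \<Rightarrow> 'h::euclidean_space) p' E' H' \<longleftrightarrow>
   (let ps = (\<lambda>x. p' x + p x); Es = (\<lambda>x. E' x + E x); Hs = (\<lambda>x. H' x + H x) in
    (\<forall>q\<in>Vp.
       L2_inner \<Omega> (\<lambda>x. (p' x - p x) / (dt / 2)) q
       - 1 / 2 * L2_inner \<Omega> (\<lambda>x. (\<epsilon> / 2) *\<^sub>R Es x) (wgrad \<Omega> q)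
       + (\<Sum>k\<in>K_set R. gamma_coef dt k / 2 ^ (2 * sum_list k + 1) *
            L2_inner \<Omega> (\<lambda>x. (\<epsilon> / 2) *\<^sub>R graddiv_pow \<Omega> (sum_list k) Es x) (wgrad \<Omega> q)) = 0) \<and>
    (\<forall>F\<in>VE.
       1 / 2 * L2_inner \<Omega> (\<lambda>x. (1 / 2) *\<^sub>R wgrad \<Omega> ps x) F
       - (\<Sum>k\<in>K_set R. gamma_coef dt k / 2 ^ (2 * sum_list k + 1) *
            L2_inner \<Omega> (\<lambda>x. (1 / 2) *\<^sub>R wgrad \<Omega> ps x) (graddiv_pow \<Omega> (sum_list k) F))
       + L2_inner \<Omega> (\<lambda>x. \<epsilon> *\<^sub>R ((E' x - E x) /\<^sub>R (dt / 2))) F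
       - L2_inner \<Omega> (\<lambda>x. (1 / 2) *\<^sub>R Hs x) (cE F)
       + (\<Sum>k\<in>K_set R. gamma_coef dt k / 2 ^ (2 * sum_list k) * (-1) ^ sum_list k *
            L2_inner \<Omega> (\<lambda>x. (1 / 2 * inverse ((\<mu> * \<epsilon>) ^ sum_list k)) *\<^sub>R
                              curlcurl_pow cE cH (sum_list k) Hs x) (cE F)) = 0) \<and>
    (\<forall>G\<in>VH.
       L2_inner \<Omega> (\<lambda>x. \<mu> *\<^sub>R ((H' x - H x) /\<^sub>R dt)) G
       + 1 / 2 * L2_inner \<Omega> (\<lambda>x. (1 / 2) *\<^sub>R cE Es x) G
       - (\<Sum>k\<in>K_set R. gamma_coef dt k / 2 ^ (2 * sum_list k + 1) * (-1) ^ sum_list k *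
            L2_inner \<Omega> (\<lambda>x. (1 / 2 * inverse ((\<epsilon> * \<mu>) ^ sum_list k)) *\<^sub>R cE Es x)
                        (curlcurl_pow cE cH (sum_list k) G)) = 0))"

text \<open>
  Time indexing: \<open>p n\<close> and \<open>E n\<close> are the values at time \<open>(n + 1/2) dt\<close>, whereas \<open>H n\<close> is the value at
  time \<open>n dt\<close>, for \<open>n \<ge> 1\<close>. The initial data are separate, and \<open>H 0\<close> is not used.
\<close>

definition LF_solution where
  "LF_solution (\<Omega> :: (real^'d::finite) set) Vp VE VH cE cH \<epsilon> \<mu> dt R (N::nat)
     p\<^sub>0 E\<^sub>0 (H\<^sub>0 :: real^'d \<Rightarrow> 'h::euclidean_space) p E H \<longleftrightarrow>
     p\<^sub>0 \<in> Vp \<and> E\<^sub>0 \<in> VE \<and> H\<^sub>0 \<in> VH \<and>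
     (\<forall>n<N. p n \<in> Vp \<and> E n \<in> VE \<and> H (n + 1) \<in> VH) \<and>
     LF_bootstrap \<Omega> Vp VE VH cE cH \<epsilon> \<mu> dt R p\<^sub>0 E\<^sub>0 H\<^sub>0 (p 0) (E 0) (H 1) \<and>
     (\<forall>n\<in>{1..<N}. LF_step \<Omega> Vp VE VH cE cH \<epsilon> \<mu> dt R
        (p (n - 1)) (E (n - 1)) (H n) (p n) (E n) (H (n + 1)))"

text \<open>
  The electric and magnetic spaces below carry the regularity that makes the powers of \<open>grad div\<close> and
  \<open>curl curl\<close> of order up to \<open>R/2 - 1\<close> meaningful; for \<open>R = 2\<close> this is no restriction.
\<close>

definition LF_solution_3d where
  "LF_solution_3d \<Omega> \<epsilon> \<mu> dt R = LF_solution \<Omega>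
     (H1_0 \<Omega> (inverse \<epsilon>))
     (Hcurl3_0 \<Omega> \<epsilon> \<inter> pow_dom \<Omega> div_adj grad_adj (R div 2 - 1))
     (Hdiv3_0 \<Omega> \<mu> \<inter> pow_dom \<Omega> curl3 curl3 (R div 2 - 1))
     (wcurl3 \<Omega>) (wcurl3 \<Omega>) \<epsilon> \<mu> dt R"

definition LF_solution_2d where
  "LF_solution_2d \<Omega> \<epsilon> \<mu> dt R = LF_solution \<Omega>
     (H1_0 \<Omega> (inverse \<epsilon>))
     (Hcurl2_0 \<Omega> \<epsilon> \<inter> pow_dom \<Omega> div_adj grad_adj (R div 2 - 1))
     (Hdiv2_0 \<Omega> \<inter> pow_dom \<Omega> scurl2 vcurl2 (R div 2 - 1))
     (wscurl2 \<Omega>) (wvcurl2 \<Omega>) \<epsilon> \<mu> dt R"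

end

theory Submission
  imports Defs
begin

text \<open>
  Test the three equations with the sums of the new and the old values. In \<open>\<epsilon>\<^sup>-\<^sup>1 (S1) + (S2) + (S3)\<close> the
  terms with spatial derivatives then cancel in pairs, without any integration by parts, and the
  difference quotients telescope. For the bootstrapping step the combination is
  \<open>\<epsilon>\<^sup>-\<^sup>1 (B1) + (B2) + 2 (B3)\<close>. The analytic content is that the sums are admissible test functions,
  i.e. that the spaces are closed under addition, and that they consist of \<open>L2\<close> functions.
\<close>

section \<open>Square-integrable functions\<close>

lemma L2_measurable: "u \<in> L2 \<Omega> \<Longrightarrow> u \<in> borel_measurable (lebesgue_on \<Omega>)"
  by (simp add: L2_def)

text \<open>Cauchy-Schwarz and 2ab <= a^2 + b^2 dominate the pointwise inner product by the sum of
  the squared norms. The Bochner integral of a non-integrable function is 0 by default, so splitting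
  an \<open>L2_inner\<close> of sums rests on this fact.\<close>

lemma L2_inner_integrable:
  assumes "u \<in> L2 \<Omega>" "v \<in> L2 \<Omega>"
  shows "integrable (lebesgue_on \<Omega>) (\<lambda>x. u x \<bullet> v x)"
proof (rule Bochner_Integration.integrable_bound)
  show "integrable (lebesgue_on \<Omega>) (\<lambda>x. (norm (u x))\<^sup>2 + (norm (v x))\<^sup>2)"
    using assms by (simp add: L2_def)
  show "(\<lambda>x. u x \<bullet> v x) \<in> borel_measurable (lebesgue_on \<Omega>)"
    using assms by (intro borel_measurable_inner L2_measurable)
  have "\<bar>a \<bullet> b\<bar> \<le> (norm a)\<^sup>2 + (norm b)\<^sup>2" for a b :: 'b
  proof -
    have "\<bar>a \<bullet> b\<bar> \<le> norm a * norm b" by (rule Cauchy_Schwarz_ineq2)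
    also have "\<dots> \<le> (norm a)\<^sup>2 + (norm b)\<^sup>2"
      using sum_squares_bound[of "norm a" "norm b"] mult_nonneg_nonneg[OF norm_ge_zero norm_ge_zero, of a b]
      by linarith
    finally show ?thesis .
  qed
  then show "AE x in lebesgue_on \<Omega>. norm (u x \<bullet> v x) \<le> norm ((norm (u x))\<^sup>2 + (norm (v x))\<^sup>2)"
    by simp
qed

lemma L2_scaleR:
  assumes "u \<in> L2 \<Omega>"
  shows "(\<lambda>x. c *\<^sub>R u x) \<in> L2 \<Omega>"
  using assms by (auto simp: L2_def power_mult_distrib)

lemma L2_add:
  assumes "u \<in> L2 \<Omega>" "v \<in> L2 \<Omega>"
  shows "(\<lambda>x. u x + v x) \<in> L2 \<Omega>"
proof -
  have "(norm (u x + v x))\<^sup>2 = (norm (u x))\<^sup>2 + 2 * (u x \<bullet> v x) + (norm (v x))\<^sup>2" for x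
    by (simp add: power2_norm_eq_inner inner_add_left inner_add_right inner_commute)
  then show ?thesis
    using assms L2_inner_integrable[OF assms] by (auto simp: L2_def)
qed

lemma L2_diff:
  assumes "u \<in> L2 \<Omega>" "v \<in> L2 \<Omega>"
  shows "(\<lambda>x. u x - v x) \<in> L2 \<Omega>"
  using L2_add[OF assms(1) L2_scaleR[OF assms(2), of "-1"]] by simp

lemma L2_inner_commute: "L2_inner \<Omega> u v = L2_inner \<Omega> v u"
  by (simp add: L2_inner_def inner_commute)

lemma L2_inner_scaleR_left: "L2_inner \<Omega> (\<lambda>x. c *\<^sub>R u x) v = c * L2_inner \<Omega> u v"
  by (simp add: L2_inner_def)

lemma L2_inner_add_left:
  assumes "u \<in> L2 \<Omega>" "v \<in> L2 \<Omega>" "w \<in> L2 \<Omega>"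
  shows "L2_inner \<Omega> (\<lambda>x. u x + v x) w = L2_inner \<Omega> u w + L2_inner \<Omega> v w"
  using L2_inner_integrable[OF assms(1,3)] L2_inner_integrable[OF assms(2,3)]
  by (simp add: L2_inner_def inner_add_left)

lemma wnorm_sq_eq: "wnorm_sq \<Omega> w u = w * L2_inner \<Omega> u u"
  by (simp add: wnorm_sq_def L2_inner_scaleR_left)

text \<open>By symmetry of the inner product the mixed terms cancel pointwise. This turns a
  difference quotient tested with the sum of the new and the old value into a difference of squared
  norms.\<close>

lemma L2_inner_diff_sum:
  assumes "u \<in> L2 \<Omega>" "v \<in> L2 \<Omega>"
  shows "L2_inner \<Omega> (\<lambda>x. u x - v x) (\<lambda>x. u x + v x) = L2_inner \<Omega> u u - L2_inner \<Omega> v v"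
proof -
  have "(u x - v x) \<bullet> (u x + v x) = u x \<bullet> u x - v x \<bullet> v x" for x
    by (simp add: inner_diff_left inner_add_right inner_commute[of "v x" "u x"])
  then show ?thesis
    using L2_inner_integrable[OF assms(1,1)] L2_inner_integrable[OF assms(2,2)]
    by (simp add: L2_inner_def)
qed

lemma L2_inner_self_nonneg: "0 \<le> L2_inner \<Omega> u u"
  by (simp add: L2_inner_def)

text \<open>Expanding |u - v|^2 >= 0 pointwise gives the bound. It takes the place of the triangle
  inequality, since \<open>graph_closure\<close> measures errors by squared norms.\<close>

lemma L2_inner_self_add_le:
  assumes "u \<in> L2 \<Omega>" "v \<in> L2 \<Omega>"
  shows "L2_inner \<Omega> (\<lambda>x. u x + v x) (\<lambda>x. u x + v x) \<le> 2 * L2_inner \<Omega> u u + 2 * L2_inner \<Omega> v v"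
proof -
  have "(u x + v x) \<bullet> (u x + v x) \<le> 2 * (u x \<bullet> u x) + 2 * (v x \<bullet> v x)" for x
    using inner_ge_zero[of "u x - v x"]
    by (simp add: inner_diff_left inner_diff_right inner_add_left inner_add_right inner_commute)
  then have "L2_inner \<Omega> (\<lambda>x. u x + v x) (\<lambda>x. u x + v x)
      \<le> integral\<^sup>L (lebesgue_on \<Omega>) (\<lambda>x. 2 * (u x \<bullet> u x) + 2 * (v x \<bullet> v x))"
    unfolding L2_inner_def
    by (intro integral_mono L2_inner_integrable L2_add assms Bochner_Integration.integrable_add
        integrable_mult_right)
  also have "\<dots> = 2 * L2_inner \<Omega> u u + 2 * L2_inner \<Omega> v v"
    using L2_inner_integrable[OF assms(1,1)] L2_inner_integrable[OF assms(2,2)]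
    by (simp add: L2_inner_def)
  finally show ?thesis .
qed

text \<open>A continuous function is integrable over the compact set \<open>K\<close>. As
  \<open>f\<close> vanishes off \<open>K\<close>, the indicators of \<open>K\<close> and of \<Omega>
  cut out the same function, which carries integrability over to \<Omega>; completion passes from
  Borel to Lebesgue measure.\<close>

lemma L2_continuous_compact_support:
  fixes f :: "'a::euclidean_space \<Rightarrow> 'b::euclidean_space"
  assumes f: "continuous_on UNIV f" and K: "compact K" "K \<subseteq> \<Omega>" and \<Omega>: "open \<Omega>"
    and zero: "\<And>x. x \<notin> K \<Longrightarrow> f x = 0"
  shows "f \<in> L2 \<Omega>"
proof -
  have meas: "f \<in> borel_measurable (lebesgue_on \<Omega>)"
    using f \<Omega> by (intro continuous_imp_measurable_on_sets_lebesgue) (auto intro: continuous_on_subset)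
  have "set_integrable lborel K (\<lambda>x. (norm (f x))\<^sup>2)"
    unfolding set_integrable_def
    by (rule borel_integrable_compact)
      (use K f in \<open>auto intro!: continuous_intros intro: continuous_on_subset\<close>)
  moreover have "(\<lambda>x. indicator K x *\<^sub>R (norm (f x))\<^sup>2) = (\<lambda>x. indicator \<Omega> x *\<^sub>R (norm (f x))\<^sup>2)"
    using K zero by (auto simp: indicator_def fun_eq_iff)
  ultimately have "integrable lebesgue (\<lambda>x. indicator \<Omega> x *\<^sub>R (norm (f x))\<^sup>2)"
    by (simp add: set_integrable_def integrable_completion)
  then have "integrable (lebesgue_on \<Omega>) (\<lambda>x. (norm (f x))\<^sup>2)"
    using \<Omega> by (subst integrable_restrict_space) auto
  then show ?thesis using meas by (simp add: L2_def)
qed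

section \<open>Test functions\<close>

lemma test_fns_differentiable: "\<phi> \<in> test_fns \<Omega> \<Longrightarrow> \<phi> differentiable (at x)"
  unfolding test_fns_def by (simp only: mem_Collect_eq) (metis C_k.simps(2))

lemma test_fns_continuous: "\<phi> \<in> test_fns \<Omega> \<Longrightarrow> continuous_on UNIV \<phi>"
  unfolding test_fns_def by (simp only: mem_Collect_eq) (metis C_k.simps(1))

lemma test_fns_deriv_continuous:
  assumes "\<phi> \<in> test_fns \<Omega>" "b \<in> Basis"
  shows "continuous_on UNIV (\<lambda>x. frechet_derivative \<phi> (at x) b)"
proof -
  have "C_k (Suc 0) \<phi>" using assms(1) by (simp only: test_fns_def mem_Collect_eq)
  then show ?thesis using assms(2) by simp
qed

lemma frechet_derivative_add:
  assumes "f differentiable (at x)" "g differentiable (at x)"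
  shows "frechet_derivative (\<lambda>y. f y + g y) (at x) =
    (\<lambda>h. frechet_derivative f (at x) h + frechet_derivative g (at x) h)"
  using has_derivative_add[OF assms[THEN frechet_derivative_works[THEN iffD1]]]
  by (rule frechet_derivative_at[symmetric])

lemma C_k_add: "C_k k f \<Longrightarrow> C_k k g \<Longrightarrow> C_k k (\<lambda>x. f x + g x)"
proof (induction k arbitrary: f g)
  case 0
  then show ?case by (simp add: continuous_on_add)
next
  case (Suc k)
  then show ?case by (simp add: frechet_derivative_add)
qed

text \<open>Cancellation can make the support of the sum smaller than the union \<open>K\<close> of
  the two supports. It is still a closed subset of the compact set \<open>K\<close>, hence compact
  and inside \<Omega>.\<close>

lemma test_fns_add:
  assumes "\<phi> \<in> test_fns \<Omega>" "\<psi> \<in> test_fns \<Omega>"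
  shows "(\<lambda>x. \<phi> x + \<psi> x) \<in> test_fns \<Omega>"
proof -
  define K where "K = closure {x. \<phi> x \<noteq> 0} \<union> closure {x. \<psi> x \<noteq> 0}"
  define S where "S = closure {x. \<phi> x + \<psi> x \<noteq> 0}"
  have K: "compact K" "K \<subseteq> \<Omega>" using assms by (simp_all add: test_fns_def K_def compact_Un)
  have "x \<in> K" if "\<phi> x + \<psi> x \<noteq> 0" for x
  proof (cases "\<phi> x = 0")
    case True
    then have "\<psi> x \<noteq> 0" using that by simp
    then show ?thesis using closure_subset[of "{x. \<psi> x \<noteq> 0}"] unfolding K_def by blast
  next
    case False
    then show ?thesis using closure_subset[of "{x. \<phi> x \<noteq> 0}"] unfolding K_def by blast
  qed
  then have "S \<subseteq> K"
    unfolding S_def using K(1) by (intro closure_minimal compact_imp_closed) auto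
  moreover have "compact (K \<inter> S)"
    unfolding S_def using K(1) closed_closure by (rule compact_Int_closed)
  ultimately have "compact S" "S \<subseteq> \<Omega>" using K(2) by (simp_all only: inf.absorb2 order_trans)
  moreover have "C_k k (\<lambda>x. \<phi> x + \<psi> x)" for k
    using assms by (intro C_k_add) (simp_all add: test_fns_def)
  ultimately show ?thesis
    unfolding test_fns_def S_def by simp
qed

text \<open>The complement of the closed support is an open neighbourhood of \<open>x\<close> on
  which the function agrees with zero.\<close>

lemma frechet_derivative_zero_outside_support:
  fixes \<phi> :: "'a::euclidean_space \<Rightarrow> 'b::euclidean_space"
  assumes "x \<notin> closure {x. \<phi> x \<noteq> 0}"
  shows "frechet_derivative \<phi> (at x) = (\<lambda>h. 0)"
proof -
  have "(\<phi> has_derivative (\<lambda>h. 0)) (at x)"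
  proof (rule has_derivative_transform_within_open[where f = "\<lambda>x. 0"])
    show "open (- closure {x. \<phi> x \<noteq> 0})" by (rule open_Compl) (rule closed_closure)
    show "x \<in> - closure {x. \<phi> x \<noteq> 0}" using assms by simp
    show "0 = \<phi> y" if "y \<in> - closure {x. \<phi> x \<noteq> 0}" for y
      using that closure_subset[of "{x. \<phi> x \<noteq> 0}"] by auto
  qed simp
  then show ?thesis by (rule frechet_derivative_at[symmetric])
qed

lemma test_fns_L2:
  assumes "open \<Omega>" "\<phi> \<in> test_fns \<Omega>"
  shows "\<phi> \<in> L2 \<Omega>"
proof (rule L2_continuous_compact_support[OF test_fns_continuous[OF assms(2)]])
  show "\<phi> x = 0" if "x \<notin> closure {x. \<phi> x \<noteq> 0}" for x
    using that closure_subset[of "{x. \<phi> x \<noteq> 0}"] by auto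
qed (use assms in \<open>auto simp: test_fns_def\<close>)

section \<open>First-order operators with constant coefficients\<close>

text \<open>\<open>S b\<close> is the coefficient of the derivative in direction \<open>b\<close>,
  that is, the symbol of the operator at \<open>b\<close>. Gradient, divergence and all the curls
  have this form, so additivity and square integrability are proved once for all of them. The
  formula is asked for at points of differentiability, because \<open>frechet_derivative\<close> is
  an arbitrary choice elsewhere.\<close>

definition first_order ::
    "(('a::euclidean_space \<Rightarrow> 'b::euclidean_space) \<Rightarrow> 'a \<Rightarrow> 'c::euclidean_space) \<Rightarrow> bool" where
  "first_order D \<longleftrightarrow> (\<exists>S. (\<forall>b. linear (S b)) \<and>
     (\<forall>\<phi> x. \<phi> differentiable (at x) \<longrightarrow>
        D \<phi> x = (\<Sum>b\<in>Basis. S b (frechet_derivative \<phi> (at x) b))))"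

lemma first_order_add:
  assumes "first_order D" "\<phi> \<in> test_fns \<Omega>" "\<psi> \<in> test_fns \<Omega>"
  shows "D (\<lambda>x. \<phi> x + \<psi> x) x = D \<phi> x + D \<psi> x"
proof -
  note d = test_fns_differentiable[OF assms(2)] test_fns_differentiable[OF assms(3)]
  show ?thesis
    using assms(1) d
    by (auto simp: first_order_def frechet_derivative_add linear_add sum.distrib)
qed

text \<open>The image is continuous because the first derivatives of a test function are, and it
  vanishes off the support together with them.\<close>

lemma first_order_L2:
  assumes "first_order D" "open \<Omega>" "\<phi> \<in> test_fns \<Omega>"
  shows "D \<phi> \<in> L2 \<Omega>"
proof -
  obtain S where S: "\<And>b. linear (S b)"
    and D: "\<And>x. D \<phi> x = (\<Sum>b\<in>Basis. S b (frechet_derivative \<phi> (at x) b))"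
    using assms(1) test_fns_differentiable[OF assms(3)] unfolding first_order_def by metis
  show ?thesis
  proof (rule L2_continuous_compact_support)
    show "continuous_on UNIV (D \<phi>)"
      unfolding D[abs_def]
      by (intro continuous_on_sum linear_continuous_on_compose[OF _ S]
          test_fns_deriv_continuous[OF assms(3)])
    show "D \<phi> x = 0" if "x \<notin> closure {x. \<phi> x \<noteq> 0}" for x
      using that S by (simp add: D frechet_derivative_zero_outside_support linear_0)
  qed (use assms in \<open>auto simp: test_fns_def\<close>)
qed

section \<open>Symbols of the gradient, the divergence and the curls\<close>

lemma sum_Basis_axis:
  fixes f :: "real^'n::finite \<Rightarrow> 'b::comm_monoid_add"
  shows "(\<Sum>b\<in>Basis. f b) = (\<Sum>i\<in>UNIV. f (axis i 1))"
proof -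
  have inj: "inj (\<lambda>i :: 'n. axis i (1::real))" by (simp add: inj_on_def axis_eq_axis)
  have "(Basis :: (real^'n) set) = range (\<lambda>i. axis i 1)" by (auto simp: Basis_vec_def)
  then have "(\<Sum>b\<in>Basis. f b) = sum f (range (\<lambda>i. axis i 1))" by (rule arg_cong)
  also have "\<dots> = (\<Sum>i\<in>UNIV. f (axis i 1))" unfolding sum.reindex[OF inj] by (simp add: o_def)
  finally show ?thesis .
qed

text \<open>The classical operators differentiate one component at a time, whereas
  \<open>first_order\<close> uses the derivative of the whole field. Taking a component is bounded
  linear and so commutes with differentiation.\<close>

lemma pd_nth:
  assumes "u differentiable (at x)"
  shows "pd i (\<lambda>y. u y $ j) x = frechet_derivative u (at x) (axis i 1) $ j"
proof -
  have "((\<lambda>y. u y $ j) has_derivative (\<lambda>h. frechet_derivative u (at x) h $ j)) (at x)"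
    using assms by (intro bounded_linear.has_derivative[OF bounded_linear_vec_nth])
      (simp add: frechet_derivative_works)
  then show ?thesis unfolding pd_def by (metis frechet_derivative_at)
qed

lemma first_order_uminus: "first_order D \<Longrightarrow> first_order (\<lambda>\<phi> x. - D \<phi> x)"
proof -
  assume "first_order D"
  then obtain S where S: "\<And>b. linear (S b)"
    and D: "\<And>\<phi> x. \<phi> differentiable (at x) \<Longrightarrow>
      D \<phi> x = (\<Sum>b\<in>Basis. S b (frechet_derivative \<phi> (at x) b))"
    unfolding first_order_def by metis
  show ?thesis unfolding first_order_def
    by (rule exI[of _ "\<lambda>b v. - S b v"]) (simp add: S D linear_compose_neg sum_negf)
qed

lemma first_order_grad: "first_order (grad :: _ \<Rightarrow> real^'d::finite \<Rightarrow> _)"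
proof -
  have "(\<Sum>j\<in>UNIV. f j *\<^sub>R axis j 1) $ i = f i" for f :: "'d \<Rightarrow> real" and i
    by (simp add: axis_def if_distrib cong: if_cong)
  then show ?thesis
    unfolding first_order_def
    by (intro exI[of _ "\<lambda>b r. r *\<^sub>R b"])
      (simp add: grad_def pd_def sum_Basis_axis vec_eq_iff linear_iff distrib_right)
qed

lemma first_order_diverg: "first_order (diverg :: _ \<Rightarrow> real^'d::finite \<Rightarrow> _)"
  unfolding first_order_def
  by (rule exI[of _ "\<lambda>b v. b \<bullet> v"])
    (auto simp: diverg_def pd_nth sum_Basis_axis inner_axis' linear_iff inner_add_right)

text \<open>The curl is the sum of the cross products of the basis vectors \<open>b\<close> with the
  derivatives along \<open>b\<close>.\<close>

lemma first_order_curl3: "first_order curl3"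
  unfolding first_order_def
  by (rule exI[of _ "cross3"])
    (auto simp: curl3_def pd_nth sum_Basis_axis sum_3 cross3_def vec_eq_iff forall_3 axis_def
      linear_iff algebra_simps)

lemma first_order_scurl2: "first_order scurl2"
  unfolding first_order_def
  by (rule exI[of _ "\<lambda>b v. b $ 1 * v $ 2 - b $ 2 * v $ 1"])
    (auto simp: scurl2_def pd_nth sum_Basis_axis sum_2 axis_def linear_iff algebra_simps)

text \<open>The vector curl is the gradient turned clockwise by a right angle, so its symbol is the
  turned basis vector.\<close>

lemma first_order_vcurl2: "first_order vcurl2"
  unfolding first_order_def
  by (rule exI[of _ "\<lambda>b r. r *\<^sub>R vector [b $ 2, - b $ 1]"])
    (auto simp: vcurl2_def pd_def sum_Basis_axis sum_2 vec_eq_iff forall_2 axis_def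
      linear_iff algebra_simps)

lemma first_order_grad_adj: "first_order (grad_adj :: _ \<Rightarrow> real^'d::finite \<Rightarrow> _)"
  using first_order_uminus[OF first_order_diverg] by (simp add: grad_adj_def[abs_def])

lemma first_order_div_adj: "first_order (div_adj :: _ \<Rightarrow> real^'d::finite \<Rightarrow> _)"
  using first_order_uminus[OF first_order_grad] by (simp add: div_adj_def[abs_def])

section \<open>The trial spaces are closed under addition\<close>

text \<open>Both sides of the defining identity are additive in the first slot, provided that the
  second slot is in \<open>L2\<close>. This holds for test functions and for their images under
  \<open>A\<close>.\<close>

lemma has_weak_add:
  assumes A: "first_order A" and \<Omega>: "open \<Omega>"
    and 1: "has_weak \<Omega> A u v" and 2: "has_weak \<Omega> A u' v'"
  shows "has_weak \<Omega> A (\<lambda>x. u x + u' x) (\<lambda>x. v x + v' x)"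
  unfolding has_weak_def
proof (intro conjI ballI)
  note L2s = 1[unfolded has_weak_def] 2[unfolded has_weak_def]
  show "(\<lambda>x. u x + u' x) \<in> L2 \<Omega>" "(\<lambda>x. v x + v' x) \<in> L2 \<Omega>" using L2s by (simp_all add: L2_add)
  show "L2_inner \<Omega> (\<lambda>x. u x + u' x) (A \<phi>) = L2_inner \<Omega> (\<lambda>x. v x + v' x) \<phi>"
    if "\<phi> \<in> test_fns \<Omega>" for \<phi>
    using L2s that L2_inner_add_left[OF _ _ first_order_L2[OF A \<Omega> that], of u u']
      L2_inner_add_left[OF _ _ test_fns_L2[OF \<Omega> that], of v v']
    by simp
qed

lemma pow_dom_subset_L2: "pow_dom \<Omega> A B m \<subseteq> L2 \<Omega>"
  by (cases m) (auto simp: has_weak_def)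

text \<open>Membership asks for the existence of intermediate weak derivatives, so the witnesses of
  the two functions are added level by level. The induction generalises over \<open>u\<close> and
  \<open>v\<close> because the smaller power is applied to the second-order derivatives.\<close>

lemma pow_dom_add:
  assumes "first_order A" "first_order B" "open \<Omega>"
  shows "u \<in> pow_dom \<Omega> A B m \<Longrightarrow> v \<in> pow_dom \<Omega> A B m \<Longrightarrow> (\<lambda>x. u x + v x) \<in> pow_dom \<Omega> A B m"
proof (induction m arbitrary: u v)
  case 0
  then show ?case by (simp add: L2_add)
next
  case (Suc m)
  from Suc.prems obtain a b a' b' where
    "has_weak \<Omega> A u a" "has_weak \<Omega> B a b" "b \<in> pow_dom \<Omega> A B m"
    "has_weak \<Omega> A v a'" "has_weak \<Omega> B a' b'" "b' \<in> pow_dom \<Omega> A B m"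
    by auto
  then have "has_weak \<Omega> A (\<lambda>x. u x + v x) (\<lambda>x. a x + a' x)"
    "has_weak \<Omega> B (\<lambda>x. a x + a' x) (\<lambda>x. b x + b' x)"
    "(\<lambda>x. b x + b' x) \<in> pow_dom \<Omega> A B m"
    using assms Suc.IH by (simp_all add: has_weak_add)
  then show ?case by auto
qed

lemma graph_closure_subset_L2: "graph_closure \<Omega> w D A \<subseteq> L2 \<Omega>"
  by (auto simp: graph_closure_def has_weak_def)

text \<open>The approximating sequences are added. The squared graph-norm error of the sum is at
  most twice the sum of the two errors, and hence tends to zero.\<close>

lemma graph_closure_add:
  assumes D: "first_order D" and A: "first_order A" and \<Omega>: "open \<Omega>" and w: "0 < w"
    and u: "u \<in> graph_closure \<Omega> w D A" and u': "u' \<in> graph_closure \<Omega> w D A"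
  shows "(\<lambda>x. u x + u' x) \<in> graph_closure \<Omega> w D A"
proof -
  define err where "err = (\<lambda>u v \<phi>. wnorm_sq \<Omega> w (\<lambda>x. u x - \<phi> x) + wnorm_sq \<Omega> w (\<lambda>x. v x - D \<phi> x))"
  obtain v \<phi> where v: "has_weak \<Omega> A u v" and \<phi>: "\<And>j. \<phi> j \<in> test_fns \<Omega>"
    and lim: "(\<lambda>j. err u v (\<phi> j)) \<longlonglongrightarrow> 0"
    using u by (auto simp: graph_closure_def err_def)
  obtain v' \<phi>' where v': "has_weak \<Omega> A u' v'" and \<phi>': "\<And>j. \<phi>' j \<in> test_fns \<Omega>"
    and lim': "(\<lambda>j. err u' v' (\<phi>' j)) \<longlonglongrightarrow> 0"
    using u' by (auto simp: graph_closure_def err_def)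
  define \<psi> where "\<psi> = (\<lambda>j x. \<phi> j x + \<phi>' j x)"
  define U where "U = (\<lambda>x. u x + u' x)"
  define V where "V = (\<lambda>x. v x + v' x)"
  \<comment> \<open>The fresh value type \<open>'e\<close> lets this bound serve both the functions
    and their weak derivatives, whose values may lie in different spaces.\<close>
  have wnorm_add: "wnorm_sq \<Omega> w (\<lambda>x. f x + f' x) \<le> 2 * wnorm_sq \<Omega> w f + 2 * wnorm_sq \<Omega> w f'"
    if "f \<in> L2 \<Omega>" "f' \<in> L2 \<Omega>" for f f' :: "'a \<Rightarrow> 'e::euclidean_space"
    using mult_left_mono[OF L2_inner_self_add_le[OF that], of w] w
    by (simp add: wnorm_sq_eq algebra_simps)
  have nonneg: "0 \<le> err a b \<theta>" for a b \<theta>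
    using w by (simp add: err_def wnorm_sq_eq L2_inner_self_nonneg)
  have bound: "err U V (\<psi> j) \<le> 2 * err u v (\<phi> j) + 2 * err u' v' (\<phi>' j)" for j
  proof -
    have L2: "u \<in> L2 \<Omega>" "v \<in> L2 \<Omega>" "u' \<in> L2 \<Omega>" "v' \<in> L2 \<Omega>"
      using v v' by (simp_all only: has_weak_def)
    have "wnorm_sq \<Omega> w (\<lambda>x. U x - \<psi> j x) = wnorm_sq \<Omega> w (\<lambda>x. (u x - \<phi> j x) + (u' x - \<phi>' j x))"
      by (simp add: U_def \<psi>_def algebra_simps)
    also have "\<dots> \<le> 2 * wnorm_sq \<Omega> w (\<lambda>x. u x - \<phi> j x) + 2 * wnorm_sq \<Omega> w (\<lambda>x. u' x - \<phi>' j x)"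
      by (intro wnorm_add L2_diff L2 test_fns_L2[OF \<Omega>] \<phi> \<phi>')
    finally have 1: "wnorm_sq \<Omega> w (\<lambda>x. U x - \<psi> j x) \<le>
      2 * wnorm_sq \<Omega> w (\<lambda>x. u x - \<phi> j x) + 2 * wnorm_sq \<Omega> w (\<lambda>x. u' x - \<phi>' j x)" .
    have "wnorm_sq \<Omega> w (\<lambda>x. V x - D (\<psi> j) x) =
        wnorm_sq \<Omega> w (\<lambda>x. (v x - D (\<phi> j) x) + (v' x - D (\<phi>' j) x))"
      unfolding V_def \<psi>_def first_order_add[OF D \<phi> \<phi>'] by (simp add: algebra_simps)
    also have "\<dots> \<le> 2 * wnorm_sq \<Omega> w (\<lambda>x. v x - D (\<phi> j) x) + 2 * wnorm_sq \<Omega> w (\<lambda>x. v' x - D (\<phi>' j) x)"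
      by (intro wnorm_add L2_diff L2 first_order_L2[OF D \<Omega>] \<phi> \<phi>')
    finally have 2: "wnorm_sq \<Omega> w (\<lambda>x. V x - D (\<psi> j) x) \<le>
      2 * wnorm_sq \<Omega> w (\<lambda>x. v x - D (\<phi> j) x) + 2 * wnorm_sq \<Omega> w (\<lambda>x. v' x - D (\<phi>' j) x)" .
    have "a + b \<le> 2 * (c + d) + 2 * (e + f)" if "a \<le> 2 * c + 2 * e" "b \<le> 2 * d + 2 * f"
      for a b c d e f :: real
      using that by simp
    from this[OF 1 2] show ?thesis by (simp only: err_def)
  qed
  have "(\<lambda>j. 2 * err u v (\<phi> j) + 2 * err u' v' (\<phi>' j)) \<longlonglongrightarrow> 0"
    using tendsto_add[OF tendsto_mult_right_zero[OF lim, of 2] tendsto_mult_right_zero[OF lim', of 2]]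
    by simp
  then have "(\<lambda>j. err U V (\<psi> j)) \<longlonglongrightarrow> 0"
    by (rule tendsto_sandwich[OF always_eventually always_eventually tendsto_const, rotated 2])
      (simp_all only: nonneg bound simp_thms)
  moreover have "has_weak \<Omega> A U V" unfolding U_def V_def by (rule has_weak_add[OF A \<Omega> v v'])
  moreover have "\<forall>j. \<psi> j \<in> test_fns \<Omega>" unfolding \<psi>_def using test_fns_add[OF \<phi> \<phi>'] by simp
  ultimately have "U \<in> graph_closure \<Omega> w D A"
    unfolding graph_closure_def err_def mem_Collect_eq by (intro exI conjI)
  then show ?thesis by (simp only: U_def)
qed

section \<open>Conservation of energy\<close>

definition energy where
  "energy \<Omega> \<epsilon> \<mu> p E H = wnorm_sq \<Omega> (inverse \<epsilon>) p + wnorm_sq \<Omega> \<epsilon> E + wnorm_sq \<Omega> \<mu> H"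

text \<open>\<open>X\<close> stands for the coupling of \<open>p\<close> with \<open>E\<close> and
  \<open>Y\<close> for that of \<open>E\<close> with \<open>H\<close>, higher-order terms included.
  Dividing the first equation by \<epsilon> produces the weight of the \<open>p\<close>-norm, and
  the three right-hand sides then add up to zero. The factor \<open>c\<close> is 1/dt for a regular
  step and 2/dt for the bootstrapping step.\<close>

lemma energy_balance:
  assumes "0 < \<epsilon>" "0 < c"
    and "p \<in> L2 \<Omega>" "p' \<in> L2 \<Omega>" "E \<in> L2 \<Omega>" "E' \<in> L2 \<Omega>" "H \<in> L2 \<Omega>" "H' \<in> L2 \<Omega>"
    and p: "c * L2_inner \<Omega> (\<lambda>x. p' x - p x) (\<lambda>x. p' x + p x) = \<epsilon> * X"
    and E: "c * \<epsilon> * L2_inner \<Omega> (\<lambda>x. E' x - E x) (\<lambda>x. E' x + E x) = Y - X"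
    and H: "c * \<mu> * L2_inner \<Omega> (\<lambda>x. H' x - H x) (\<lambda>x. H' x + H x) = - Y"
  shows "energy \<Omega> \<epsilon> \<mu> p' E' H' = energy \<Omega> \<epsilon> \<mu> p E H"
proof -
  have "c * inverse \<epsilon> * L2_inner \<Omega> (\<lambda>x. p' x - p x) (\<lambda>x. p' x + p x) = X"
    using p assms(1) by (simp add: field_simps)
  with E H have "c * (energy \<Omega> \<epsilon> \<mu> p' E' H' - energy \<Omega> \<epsilon> \<mu> p E H) = 0"
    unfolding energy_def wnorm_sq_eq
      L2_inner_diff_sum[OF assms(4,3)] L2_inner_diff_sum[OF assms(6,5)] L2_inner_diff_sum[OF assms(8,7)]
    by (simp add: algebra_simps)
  then show ?thesis using assms(2) by simp
qed

lemma L2_inner_divide_left: "L2_inner \<Omega> (\<lambda>x. u x / c) v = L2_inner \<Omega> u v / c"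
  by (simp add: L2_inner_def)

text \<open>In (S1) the powers of grad div act on the solution, in (S2) on the test function. Once
  the test functions are the sums themselves, both are the same number up to the symmetry of the
  inner product. The powers of curl curl in (S2) and (S3) match in the same way.\<close>

lemma LF_step_energy:
  fixes H H' :: "real^'d::finite \<Rightarrow> 'h::euclidean_space"
  assumes "0 < \<epsilon>" "0 < dt"
    and L2: "p \<in> L2 \<Omega>" "p' \<in> L2 \<Omega>" "E \<in> L2 \<Omega>" "E' \<in> L2 \<Omega>" "H \<in> L2 \<Omega>" "H' \<in> L2 \<Omega>"
    and p: "(\<lambda>x. p' x + p x) \<in> Vp" and E: "(\<lambda>x. E' x + E x) \<in> VE" and H: "(\<lambda>x. H' x + H x) \<in> VH"
    and step: "LF_step \<Omega> Vp VE VH cE cH \<epsilon> \<mu> dt R p E H p' E' H'"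
  shows "energy \<Omega> \<epsilon> \<mu> p' E' H' = energy \<Omega> \<epsilon> \<mu> p E H"
proof -
  let ?ps = "\<lambda>x. p' x + p x" and ?Es = "\<lambda>x. E' x + E x" and ?Hs = "\<lambda>x. H' x + H x"
  define X where "X = L2_inner \<Omega> ?Es (wgrad \<Omega> ?ps) / 2
    - (\<Sum>k\<in>K_set R. gamma_coef dt k *
         L2_inner \<Omega> (graddiv_pow \<Omega> (sum_list k) ?Es) (wgrad \<Omega> ?ps)) / 2"
  define Y where "Y = L2_inner \<Omega> ?Hs (cE ?Es) / 2
    - (\<Sum>k\<in>K_set R. gamma_coef dt k * (-1) ^ sum_list k * (inverse ((\<mu> * \<epsilon>) ^ sum_list k) *
         L2_inner \<Omega> (curlcurl_pow cE cH (sum_list k) ?Hs) (cE ?Es))) / 2"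
  note eqs = step[unfolded LF_step_def Let_def]
  \<comment> \<open>\<open>mult_ac\<close> also reconciles the powers of \<mu>\<epsilon> in (S2)
    with those of \<epsilon>\<mu> in (S3).\<close>
  note simps = L2_inner_scaleR_left inverse_eq_divide right_diff_distrib
    sum_distrib_left sum_divide_distrib mult_ac
  show ?thesis
  proof (rule energy_balance[OF assms(1) _ L2])
    show "0 < 1 / dt" using assms(2) by simp
    show "1 / dt * L2_inner \<Omega> (\<lambda>x. p' x - p x) ?ps = \<epsilon> * X"
      using eqs[THEN conjunct1, THEN bspec, OF p, unfolded L2_inner_divide_left] by (simp add: X_def simps)
    \<comment> \<open>Fixing the left argument of the commutativity law makes it a terminating
      rewrite that brings the terms of (S2) into the form used in \<open>X\<close>.\<close>
    show "1 / dt * \<epsilon> * L2_inner \<Omega> (\<lambda>x. E' x - E x) ?Es = Y - X"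
      using eqs[THEN conjunct2, THEN conjunct1, THEN bspec, OF E]
      by (simp add: X_def Y_def simps L2_inner_commute[of _ "wgrad \<Omega> ?ps"])
    show "1 / dt * \<mu> * L2_inner \<Omega> (\<lambda>x. H' x - H x) ?Hs = - Y"
      using eqs[THEN conjunct2, THEN conjunct2, THEN bspec, OF H]
      by (simp add: Y_def simps L2_inner_commute[of _ "cE ?Es"])
  qed
qed

lemma LF_bootstrap_energy:
  fixes H H' :: "real^'d::finite \<Rightarrow> 'h::euclidean_space"
  assumes "0 < \<epsilon>" "0 < dt"
    and L2: "p \<in> L2 \<Omega>" "p' \<in> L2 \<Omega>" "E \<in> L2 \<Omega>" "E' \<in> L2 \<Omega>" "H \<in> L2 \<Omega>" "H' \<in> L2 \<Omega>"
    and p: "(\<lambda>x. p' x + p x) \<in> Vp" and E: "(\<lambda>x. E' x + E x) \<in> VE" and H: "(\<lambda>x. H' x + H x) \<in> VH"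
    and step: "LF_bootstrap \<Omega> Vp VE VH cE cH \<epsilon> \<mu> dt R p E H p' E' H'"
  shows "energy \<Omega> \<epsilon> \<mu> p' E' H' = energy \<Omega> \<epsilon> \<mu> p E H"
proof -
  let ?ps = "\<lambda>x. p' x + p x" and ?Es = "\<lambda>x. E' x + E x" and ?Hs = "\<lambda>x. H' x + H x"
  \<comment> \<open>(B1) and (B2) carry the same extra factor 1/2 in their
    \<open>p\<close>-\<open>E\<close> terms, so \<open>X\<close> absorbs it. \<open>Y\<close> is
    normalised to (B3), and the \<open>E\<close>-\<open>H\<close> terms of (B2) amount to
    \<open>2 * Y\<close>: in this step \<open>H\<close> advances by dt but \<open>p\<close> and
    \<open>E\<close> by dt/2.\<close>
  define X where "X = L2_inner \<Omega> ?Es (wgrad \<Omega> ?ps) / 2 / 2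
    - (\<Sum>k\<in>K_set R. gamma_coef dt k / 2 ^ (2 * sum_list k + 1) *
         L2_inner \<Omega> (graddiv_pow \<Omega> (sum_list k) ?Es) (wgrad \<Omega> ?ps)) / 2"
  define Y where "Y = L2_inner \<Omega> ?Hs (cE ?Es) / 4
    - (\<Sum>k\<in>K_set R. gamma_coef dt k / 2 ^ (2 * sum_list k) * (-1) ^ sum_list k *
         (inverse ((\<mu> * \<epsilon>) ^ sum_list k) *
         L2_inner \<Omega> (curlcurl_pow cE cH (sum_list k) ?Hs) (cE ?Es))) / 4"
  note eqs = step[unfolded LF_bootstrap_def Let_def]
  note simps = L2_inner_scaleR_left inverse_eq_divide right_diff_distrib
    sum_distrib_left sum_divide_distrib mult_ac
  show ?thesis
  proof (rule energy_balance[OF assms(1) _ L2])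
    show "0 < 2 / dt" using assms(2) by simp
    show "2 / dt * L2_inner \<Omega> (\<lambda>x. p' x - p x) ?ps = \<epsilon> * X"
      using eqs[THEN conjunct1, THEN bspec, OF p, unfolded L2_inner_divide_left] by (simp add: X_def simps)
    show "2 / dt * \<epsilon> * L2_inner \<Omega> (\<lambda>x. E' x - E x) ?Es = 2 * Y - X"
      using eqs[THEN conjunct2, THEN conjunct1, THEN bspec, OF E]
      by (simp add: X_def Y_def simps L2_inner_commute[of _ "wgrad \<Omega> ?ps"])
    have "1 / dt * \<mu> * L2_inner \<Omega> (\<lambda>x. H' x - H x) ?Hs = - Y"
      using eqs[THEN conjunct2, THEN conjunct2, THEN bspec, OF H]
      by (simp add: Y_def simps L2_inner_commute[of _ "cE ?Es"])
    then show "2 / dt * \<mu> * L2_inner \<Omega> (\<lambda>x. H' x - H x) ?Hs = - (2 * Y)" by simp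
  qed
qed

section \<open>Induction over the time steps\<close>

lemma LF_solution_energy:
  fixes H :: "nat \<Rightarrow> real^'d::finite \<Rightarrow> 'h::euclidean_space"
  assumes "0 < \<epsilon>" "0 < dt"
    and L2: "Vp \<subseteq> L2 \<Omega>" "VE \<subseteq> L2 \<Omega>" "VH \<subseteq> L2 \<Omega>"
    and add: "\<And>p q. p \<in> Vp \<Longrightarrow> q \<in> Vp \<Longrightarrow> (\<lambda>x. p x + q x) \<in> Vp"
      "\<And>E F. E \<in> VE \<Longrightarrow> F \<in> VE \<Longrightarrow> (\<lambda>x. E x + F x) \<in> VE"
      "\<And>H G. H \<in> VH \<Longrightarrow> G \<in> VH \<Longrightarrow> (\<lambda>x. H x + G x) \<in> VH"
    and sol: "LF_solution \<Omega> Vp VE VH cE cH \<epsilon> \<mu> dt R N p\<^sub>0 E\<^sub>0 H\<^sub>0 p E H"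
    and "n < N"
  shows "energy \<Omega> \<epsilon> \<mu> (p n) (E n) (H (n + 1)) = energy \<Omega> \<epsilon> \<mu> p\<^sub>0 E\<^sub>0 H\<^sub>0"
  using \<open>n < N\<close>
proof (induction n)
  case 0
  have init: "p\<^sub>0 \<in> Vp" "E\<^sub>0 \<in> VE" "H\<^sub>0 \<in> VH"
    and first: "p 0 \<in> Vp" "E 0 \<in> VE" "H (0 + 1) \<in> VH"
    and step: "LF_bootstrap \<Omega> Vp VE VH cE cH \<epsilon> \<mu> dt R p\<^sub>0 E\<^sub>0 H\<^sub>0 (p 0) (E 0) (H (0 + 1))"
    using sol 0 unfolding LF_solution_def by simp_all
  show ?case
    by (rule LF_bootstrap_energy[OF assms(1,2)
        subsetD[OF L2(1) init(1)] subsetD[OF L2(1) first(1)] subsetD[OF L2(2) init(2)] subsetD[OF L2(2) first(2)]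
        subsetD[OF L2(3) init(3)] subsetD[OF L2(3) first(3)]
        add(1)[OF first(1) init(1)] add(2)[OF first(2) init(2)] add(3)[OF first(3) init(3)] step])
next
  case (Suc n)
  have old: "p n \<in> Vp" "E n \<in> VE" "H (n + 1) \<in> VH"
    and new: "p (Suc n) \<in> Vp" "E (Suc n) \<in> VE" "H (Suc n + 1) \<in> VH"
    using sol Suc.prems unfolding LF_solution_def by simp_all
  have "\<forall>n\<in>{1..<N}. LF_step \<Omega> Vp VE VH cE cH \<epsilon> \<mu> dt R
      (p (n - 1)) (E (n - 1)) (H n) (p n) (E n) (H (n + 1))"
    using sol unfolding LF_solution_def by (elim conjE)
  \<comment> \<open>The scheme equation indexed by \<open>Suc n\<close> leads from the values with
    index \<open>n\<close> to those with index \<open>Suc n\<close>; the magnetic field is indexed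
    one higher at both ends.\<close>
  from bspec[OF this, of "Suc n"] Suc.prems
  have step: "LF_step \<Omega> Vp VE VH cE cH \<epsilon> \<mu> dt R
      (p n) (E n) (H (n + 1)) (p (Suc n)) (E (Suc n)) (H (Suc n + 1))"
    by simp
  have "energy \<Omega> \<epsilon> \<mu> (p (Suc n)) (E (Suc n)) (H (Suc n + 1)) = energy \<Omega> \<epsilon> \<mu> (p n) (E n) (H (n + 1))"
    by (rule LF_step_energy[OF assms(1,2)
        subsetD[OF L2(1) old(1)] subsetD[OF L2(1) new(1)] subsetD[OF L2(2) old(2)] subsetD[OF L2(2) new(2)]
        subsetD[OF L2(3) old(3)] subsetD[OF L2(3) new(3)]
        add(1)[OF new(1) old(1)] add(2)[OF new(2) old(2)] add(3)[OF new(3) old(3)] step])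
  then show ?case using Suc by simp
qed

section \<open>The planar and the spatial scheme\<close>

theorem theorem1:
  fixes \<epsilon> \<mu> T :: real and R :: nat
  assumes "\<epsilon> > 0" and "\<mu> > 0" and "T > 0" and "R \<ge> 2" and "even R"
  shows
    "(\<forall>\<Omega> :: (real^2) set. lipschitz_domain \<Omega> \<longrightarrow>
       (\<exists>\<delta>>0. \<forall>dt N p\<^sub>0 E\<^sub>0 H\<^sub>0 p E H.
          0 < dt \<and> dt < \<delta> \<and> real N * dt = T \<and>
          has_weak \<Omega> div_adj (\<lambda>x. \<epsilon> *\<^sub>R E\<^sub>0 x) p\<^sub>0 \<and>
          LF_solution_2d \<Omega> \<epsilon> \<mu> dt R N p\<^sub>0 E\<^sub>0 H\<^sub>0 p E H \<longrightarrow>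
          wnorm_sq \<Omega> (inverse \<epsilon>) (p (N - 1)) + wnorm_sq \<Omega> \<epsilon> (E (N - 1)) + wnorm_sq \<Omega> \<mu> (H N)
          = wnorm_sq \<Omega> (inverse \<epsilon>) p\<^sub>0 + wnorm_sq \<Omega> \<epsilon> E\<^sub>0 + wnorm_sq \<Omega> \<mu> H\<^sub>0)) \<and>
     (\<forall>\<Omega> :: (real^3) set. lipschitz_domain \<Omega> \<longrightarrow>
       (\<exists>\<delta>>0. \<forall>dt N p\<^sub>0 E\<^sub>0 H\<^sub>0 p E H.
          0 < dt \<and> dt < \<delta> \<and> real N * dt = T \<and>
          has_weak \<Omega> div_adj (\<lambda>x. \<epsilon> *\<^sub>R E\<^sub>0 x) p\<^sub>0 \<and>
          has_weak \<Omega> div_adj (\<lambda>x. \<mu> *\<^sub>R H\<^sub>0 x) (\<lambda>x. 0) \<and>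
          LF_solution_3d \<Omega> \<epsilon> \<mu> dt R N p\<^sub>0 E\<^sub>0 H\<^sub>0 p E H \<longrightarrow>
          wnorm_sq \<Omega> (inverse \<epsilon>) (p (N - 1)) + wnorm_sq \<Omega> \<epsilon> (E (N - 1)) + wnorm_sq \<Omega> \<mu> (H N)
          = wnorm_sq \<Omega> (inverse \<epsilon>) p\<^sub>0 + wnorm_sq \<Omega> \<epsilon> E\<^sub>0 + wnorm_sq \<Omega> \<mu> H\<^sub>0))"
\<comment> \<open>The energy lemma is available for every \<open>dt\<close> with
  \<open>0 < dt\<close>, so 1 is a possible choice of the threshold.\<close>
proof (intro conjI allI impI exI[of _ "1::real"] zero_less_one; elim conjE)
  fix \<Omega> :: "(real^2) set" and dt N p\<^sub>0 E\<^sub>0 H\<^sub>0 p E H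
  assume dom: "lipschitz_domain \<Omega>" and "0 < dt" "real N * dt = T"
    and sol: "LF_solution_2d \<Omega> \<epsilon> \<mu> dt R N p\<^sub>0 E\<^sub>0 H\<^sub>0 p E H"
  have \<Omega>: "open \<Omega>" using dom by (simp add: lipschitz_domain_def)
  \<comment> \<open>Positivity of \<open>T\<close> excludes \<open>N = 0\<close>, where the
    truncated subtraction would make \<open>N - 1\<close> equal to 0 and there would be no last
    step.\<close>
  have N: "N - 1 < N" using \<open>real N * dt = T\<close> \<open>T > 0\<close> by (cases N) simp_all
  define Vp where "Vp = H1_0 \<Omega> (inverse \<epsilon>)"
  define VE where "VE = Hcurl2_0 \<Omega> \<epsilon> \<inter> pow_dom \<Omega> div_adj grad_adj (R div 2 - 1)"
  define VH where "VH = Hdiv2_0 \<Omega> \<inter> pow_dom \<Omega> scurl2 vcurl2 (R div 2 - 1)"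
  have L2: "Vp \<subseteq> L2 \<Omega>" "VE \<subseteq> L2 \<Omega>" "VH \<subseteq> L2 \<Omega>"
    unfolding Vp_def VE_def VH_def H1_0_def
    \<comment> \<open>\<open>Vp\<close> is a graph closure; \<open>VE\<close> and \<open>VH\<close>
      are intersections, bounded here by their second factor.\<close>
    by (rule graph_closure_subset_L2 le_infI2[OF pow_dom_subset_L2])+
  have "0 < inverse \<epsilon>" using \<open>\<epsilon> > 0\<close> by simp
  then have add_p: "(\<lambda>x. f x + g x) \<in> Vp" if "f \<in> Vp" "g \<in> Vp" for f g
    using that unfolding Vp_def H1_0_def
    by (rule graph_closure_add[OF first_order_grad first_order_grad_adj \<Omega>])
  have add_E: "(\<lambda>x. f x + g x) \<in> VE" if "f \<in> VE" "g \<in> VE" for f g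
    using that unfolding VE_def Hcurl2_0_def Int_iff
    by (intro conjI graph_closure_add[OF first_order_scurl2 first_order_vcurl2 \<Omega> \<open>\<epsilon> > 0\<close>]
        pow_dom_add[OF first_order_div_adj first_order_grad_adj \<Omega>]) simp_all
  \<comment> \<open>In the plane the magnetic space is \<open>L2\<close> intersected with a power
    domain, so \<open>L2_add\<close> stands where the spatial case uses
    \<open>graph_closure_add\<close>.\<close>
  have add_H: "(\<lambda>x. f x + g x) \<in> VH" if "f \<in> VH" "g \<in> VH" for f g
    using that unfolding VH_def Hdiv2_0_def Int_iff
    by (intro conjI L2_add
        pow_dom_add[OF first_order_scurl2 first_order_vcurl2 \<Omega>]) simp_all
  have "energy \<Omega> \<epsilon> \<mu> (p (N - 1)) (E (N - 1)) (H (N - 1 + 1)) = energy \<Omega> \<epsilon> \<mu> p\<^sub>0 E\<^sub>0 H\<^sub>0"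
    by (rule LF_solution_energy[OF \<open>\<epsilon> > 0\<close> \<open>0 < dt\<close> L2 add_p add_E add_H
        sol[unfolded LF_solution_2d_def, folded Vp_def VE_def VH_def] N])
  then show "wnorm_sq \<Omega> (inverse \<epsilon>) (p (N - 1)) + wnorm_sq \<Omega> \<epsilon> (E (N - 1)) + wnorm_sq \<Omega> \<mu> (H N)
      = wnorm_sq \<Omega> (inverse \<epsilon>) p\<^sub>0 + wnorm_sq \<Omega> \<epsilon> E\<^sub>0 + wnorm_sq \<Omega> \<mu> H\<^sub>0"
    using N by (simp add: energy_def)
next
  fix \<Omega> :: "(real^3) set" and dt N p\<^sub>0 E\<^sub>0 H\<^sub>0 p E H
  assume dom: "lipschitz_domain \<Omega>" and "0 < dt" "real N * dt = T"
    and sol: "LF_solution_3d \<Omega> \<epsilon> \<mu> dt R N p\<^sub>0 E\<^sub>0 H\<^sub>0 p E H"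
  have \<Omega>: "open \<Omega>" using dom by (simp add: lipschitz_domain_def)
  have N: "N - 1 < N" using \<open>real N * dt = T\<close> \<open>T > 0\<close> by (cases N) simp_all
  define Vp where "Vp = H1_0 \<Omega> (inverse \<epsilon>)"
  define VE where "VE = Hcurl3_0 \<Omega> \<epsilon> \<inter> pow_dom \<Omega> div_adj grad_adj (R div 2 - 1)"
  define VH where "VH = Hdiv3_0 \<Omega> \<mu> \<inter> pow_dom \<Omega> curl3 curl3 (R div 2 - 1)"
  have L2: "Vp \<subseteq> L2 \<Omega>" "VE \<subseteq> L2 \<Omega>" "VH \<subseteq> L2 \<Omega>"
    unfolding Vp_def VE_def VH_def H1_0_def
    by (rule graph_closure_subset_L2 le_infI2[OF pow_dom_subset_L2])+
  have "0 < inverse \<epsilon>" using \<open>\<epsilon> > 0\<close> by simp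
  then have add_p: "(\<lambda>x. f x + g x) \<in> Vp" if "f \<in> Vp" "g \<in> Vp" for f g
    using that unfolding Vp_def H1_0_def
    by (rule graph_closure_add[OF first_order_grad first_order_grad_adj \<Omega>])
  have add_E: "(\<lambda>x. f x + g x) \<in> VE" if "f \<in> VE" "g \<in> VE" for f g
    using that unfolding VE_def Hcurl3_0_def Int_iff
    by (intro conjI graph_closure_add[OF first_order_curl3 first_order_curl3 \<Omega> \<open>\<epsilon> > 0\<close>]
        pow_dom_add[OF first_order_div_adj first_order_grad_adj \<Omega>]) simp_all
  have add_H: "(\<lambda>x. f x + g x) \<in> VH" if "f \<in> VH" "g \<in> VH" for f g
    using that unfolding VH_def Hdiv3_0_def Int_iff
    by (intro conjI graph_closure_add[OF first_order_diverg first_order_div_adj \<Omega> \<open>\<mu> > 0\<close>]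
        pow_dom_add[OF first_order_curl3 first_order_curl3 \<Omega>]) simp_all
  have "energy \<Omega> \<epsilon> \<mu> (p (N - 1)) (E (N - 1)) (H (N - 1 + 1)) = energy \<Omega> \<epsilon> \<mu> p\<^sub>0 E\<^sub>0 H\<^sub>0"
    by (rule LF_solution_energy[OF \<open>\<epsilon> > 0\<close> \<open>0 < dt\<close> L2 add_p add_E add_H
        sol[unfolded LF_solution_3d_def, folded Vp_def VE_def VH_def] N])
  then show "wnorm_sq \<Omega> (inverse \<epsilon>) (p (N - 1)) + wnorm_sq \<Omega> \<epsilon> (E (N - 1)) + wnorm_sq \<Omega> \<mu> (H N)
      = wnorm_sq \<Omega> (inverse \<epsilon>) p\<^sub>0 + wnorm_sq \<Omega> \<epsilon> E\<^sub>0 + wnorm_sq \<Omega> \<mu> H\<^sub>0"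
    using N by (simp add: energy_def)
qed

end
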